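(* Let $G$ be a finite group with $|G|\geq 3$, and let $S$ be a generating set of $G$ (with $e\notin S$) such that the undirected Cayley graph $\Gamma(G,S)$ is a complete graph. Then Player 1 has a winning strategy for $\texttt{REL}(G,S)$. Player 1 has a winning strategy for $\texttt{RAV}(G,S)$ if $|G|$ is even, and Player 2 has a winning strategy for $\texttt{RAV}(G,S)$ if $|G|$ is odd.
   Context: Games $\texttt{REL}(G,S)$ and $\texttt{RAV}(G,S)$: $G$ is a finite group and $S$ a generating set with $e\notin S$. Two players alternate turns, Player 1 first, starting from the empty word $w_0$. On turn $n$ the current player chooses $s_n\in S\cup S^{-1}$, subject to $s_n\neq s_{n-1}^{-1}$ when $n>1$, and forms $w_n=w_{n-1}s_n$. If $w_n$ represents the same element of $G$ as some $w_k$ with $0\le k<n$, the game ends: the player who formed $w_n$ wins $\texttt{REL}(G,S)$ and loses $\texttt{RAV}(G,S)$. If a player has no legal move, that player loses. The undirected Cayley graph $\Gamma(G,S)$ has vertex set $G$, with $g$ and $h$ adjacent whenever $h=gs$ for some $s\in S$. *)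

theory Defs
  imports "HOL-Algebra.Algebra" "Graph_Theory.Graph_Theory"
begin

text \<open>
  An undirected graph is represented as a symmetric digraph: each edge is a pair of opposite arcs.
\<close>

definition cayley_graph :: "('a, 'b) monoid_scheme \<Rightarrow> 'a set \<Rightarrow> 'a pair_pre_digraph" where
  "cayley_graph G S =
     \<lparr> pverts = carrier G,
       parcs = {(g, h). g \<in> carrier G \<and> h \<in> carrier G \<and>
                  (\<exists>s\<in>S. h = g \<otimes>\<^bsub>G\<^esub> s \<or> g = h \<otimes>\<^bsub>G\<^esub> s)} \<rparr>"

text \<open>
  A state of play is the word \<open>w\<^sub>n\<close> written so far, as the list of the chosen letters
  \<open>s\<^sub>1, \<dots>, s\<^sub>n\<close>. Letters are elements of the group: for an involution \<open>s\<close> the letters \<open>s\<close>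
  and \<open>s\<inverse>\<close> coincide, so \<open>s\<close> may not directly follow itself.
\<close>

datatype player = Player1 | Player2

fun opponent :: "player \<Rightarrow> player" where
  "opponent Player1 = Player2"
| "opponent Player2 = Player1"

datatype game = REL | RAV

definition word_elem :: "('a, 'b) monoid_scheme \<Rightarrow> 'a list \<Rightarrow> 'a" where
  "word_elem G w = foldl (\<lambda>g s. g \<otimes>\<^bsub>G\<^esub> s) \<one>\<^bsub>G\<^esub> w"

definition legal_moves :: "('a, 'b) monoid_scheme \<Rightarrow> 'a set \<Rightarrow> 'a list \<Rightarrow> 'a set" where
  "legal_moves G S w =
     {s \<in> S \<union> (\<lambda>t. inv\<^bsub>G\<^esub> t) ` S. w \<noteq> [] \<longrightarrow> s \<noteq> inv\<^bsub>G\<^esub> (last w)}"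

definition revisits :: "('a, 'b) monoid_scheme \<Rightarrow> 'a list \<Rightarrow> bool" where
  "revisits G w \<longleftrightarrow> (\<exists>k<length w. word_elem G (take k w) = word_elem G w)"

definition game_over :: "('a, 'b) monoid_scheme \<Rightarrow> 'a set \<Rightarrow> 'a list \<Rightarrow> bool" where
  "game_over G S w \<longleftrightarrow> revisits G w \<or> legal_moves G S w = {}"

definition to_move :: "'a list \<Rightarrow> player" where
  "to_move w = (if even (length w) then Player1 else Player2)"

text \<open>
  The winner of a finished play. The player who formed a nonempty \<open>w\<close> is
  \<open>opponent (to_move w)\<close>. If \<open>w\<close> revisits no element, the play is over because the player to
  move has no legal move, and that player loses in both games; this is why both cases agree
  for \<open>REL\<close>.
\<close>

fun winner :: "game \<Rightarrow> ('a, 'b) monoid_scheme \<Rightarrow> 'a list \<Rightarrow> player" where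
  "winner REL G w = opponent (to_move w)"
| "winner RAV G w = (if revisits G w then to_move w else opponent (to_move w))"

inductive consistent ::
  "('a, 'b) monoid_scheme \<Rightarrow> 'a set \<Rightarrow> player \<Rightarrow> ('a list \<Rightarrow> 'a) \<Rightarrow> 'a list \<Rightarrow> bool"
  for G :: "('a, 'b) monoid_scheme" and S :: "'a set" and P :: player and \<sigma> :: "'a list \<Rightarrow> 'a"
where
  start: "consistent G S P \<sigma> []"
| own_move: "\<lbrakk>consistent G S P \<sigma> w; \<not> game_over G S w; to_move w = P;
     \<sigma> w \<in> legal_moves G S w\<rbrakk> \<Longrightarrow> consistent G S P \<sigma> (w @ [\<sigma> w])"
| opponent_move: "\<lbrakk>consistent G S P \<sigma> w; \<not> game_over G S w; to_move w \<noteq> P;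
     s \<in> legal_moves G S w\<rbrakk> \<Longrightarrow> consistent G S P \<sigma> (w @ [s])"

text \<open>
  A strategy is winning for \<open>P\<close> if it always prescribes a legal move to \<open>P\<close>, every finished
  play in which \<open>P\<close> follows it is won by \<open>P\<close>, and no such play goes on forever.
\<close>

definition winning_strategy ::
  "game \<Rightarrow> ('a, 'b) monoid_scheme \<Rightarrow> 'a set \<Rightarrow> player \<Rightarrow> ('a list \<Rightarrow> 'a) \<Rightarrow> bool" where
  "winning_strategy \<Gamma> G S P \<sigma> \<longleftrightarrow>
     (\<forall>w. consistent G S P \<sigma> w \<and> \<not> game_over G S w \<and> to_move w = P \<longrightarrow>
            \<sigma> w \<in> legal_moves G S w) \<and>
     (\<forall>w. consistent G S P \<sigma> w \<and> game_over G S w \<longrightarrow> winner \<Gamma> G w = P) \<and>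
     \<not> (\<exists>f. \<forall>n. consistent G S P \<sigma> (map f [0..<n]))"

definition has_winning_strategy ::
  "game \<Rightarrow> ('a, 'b) monoid_scheme \<Rightarrow> 'a set \<Rightarrow> player \<Rightarrow> bool" where
  "has_winning_strategy \<Gamma> G S P \<longleftrightarrow> (\<exists>\<sigma>. winning_strategy \<Gamma> G S P \<sigma>)"

end

theory Submission
  imports Defs
begin

text \<open>
  Completeness of the Cayley graph means that the letters are exactly the non-identity elements,
  so a legal move leads to any vertex other than the current and the previous one. In \<open>REL\<close>,
  the first two moves form three distinct vertices and Player 1 returns to the identity on the
  third turn. In \<open>RAV\<close>, as long as unvisited vertices remain a player can move to one of them, and
  turn \<open>|G|\<close> must revisit a vertex. The player who is not on turn at turn \<open>|G|\<close> therefore wins by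
  always moving to an unvisited vertex.
\<close>

section \<open>Vertices visited along a word\<close>

lemma word_elem_snoc [simp]: "word_elem G (w @ [s]) = word_elem G w \<otimes>\<^bsub>G\<^esub> s"
  by (simp add: word_elem_def)

text \<open>The index \<open>length w\<close> is included, so the current vertex belongs to the set;
  a next move revisits exactly when it lands in it.\<close>

definition visited :: "('a, 'b) monoid_scheme \<Rightarrow> 'a list \<Rightarrow> 'a set" where
  "visited G w = (\<lambda>k. word_elem G (take k w)) ` {..length w}"

lemma visited_Nil [simp]: "visited G [] = {\<one>\<^bsub>G\<^esub>}"
  by (simp add: visited_def word_elem_def)

lemma visited_snoc [simp]:
  "visited G (w @ [s]) = insert (word_elem G w \<otimes>\<^bsub>G\<^esub> s) (visited G w)"
  by (simp add: visited_def atMost_Suc)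

lemma finite_visited [simp]: "finite (visited G w)"
  by (simp add: visited_def)

lemma word_elem_in_visited: "word_elem G w \<in> visited G w"
  by (cases w rule: rev_cases) (auto simp: word_elem_def)

lemma one_in_visited: "\<one>\<^bsub>G\<^esub> \<in> visited G w"
  by (induction w rule: rev_induct) auto

lemma revisits_snoc: "revisits G (w @ [s]) \<longleftrightarrow> word_elem G w \<otimes>\<^bsub>G\<^esub> s \<in> visited G w"
  by (auto simp: revisits_def visited_def less_Suc_eq_le image_iff) (metis atMost_iff)

lemma not_revisits_Nil [simp]: "\<not> revisits G []"
  by (simp add: revisits_def)

lemma consistent_snocD:
  assumes "consistent G S P \<sigma> (w @ [s])"
  shows "consistent G S P \<sigma> w" "\<not> game_over G S w" "s \<in> legal_moves G S w"
    "to_move w = P \<Longrightarrow> s = \<sigma> w"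
  using assms by (auto elim: consistent.cases)

text \<open>Play continues only from words without a revisit, so each letter adds a new vertex to
  the starting one.\<close>

lemma card_visited:
  assumes "consistent G S P \<sigma> w" "\<not> revisits G w"
  shows "card (visited G w) = Suc (length w)"
  using assms
proof (induction w rule: rev_induct)
  case (snoc s w)
  then have "card (visited G w) = Suc (length w)"
    using consistent_snocD[OF snoc.prems(1)] by (auto simp: game_over_def)
  then show ?case
    using snoc.prems(2) by (simp add: revisits_snoc)
qed simp

section \<open>Play on a complete Cayley graph\<close>

locale complete_cayley_game = group G for G :: "('a, 'b) monoid_scheme" (structure) +
  fixes S :: "'a set"
  assumes finite_carrier: "finite (carrier G)"
    and order_ge_3: "order G \<ge> 3"
    and letters: "S \<union> (\<lambda>t. inv t) ` S = carrier G - {\<one>}"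
begin

lemma legal_moves_iff:
  "s \<in> legal_moves G S w \<longleftrightarrow> s \<in> carrier G \<and> s \<noteq> \<one> \<and> (w \<noteq> [] \<longrightarrow> s \<noteq> inv (last w))"
  unfolding legal_moves_def letters by auto

text \<open>There are at least two letters and at most one is forbidden. Hence a play can end only
  by a revisit.\<close>

lemma legal_moves_nonempty: "legal_moves G S w \<noteq> {}"
proof
  assume "legal_moves G S w = {}"
  \<comment> \<open>For empty \<open>w\<close> the value of \<open>last w\<close> is unspecified,
    but then the carrier would already lie in the singleton of the identity.\<close>
  then have "carrier G \<subseteq> {\<one>, inv (last w)}"
    using legal_moves_iff by blast
  then have "order G \<le> card {\<one>, inv (last w)}"
    unfolding order_def by (simp add: card_mono)
  also have "\<dots> \<le> 2"
    by (simp add: card_insert_if)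
  finally show False
    using order_ge_3 by simp
qed

lemma game_over_iff: "game_over G S w \<longleftrightarrow> revisits G w"
  by (simp add: game_over_def legal_moves_nonempty)

lemma consistent_letters: "consistent G S P \<sigma> w \<Longrightarrow> set w \<subseteq> carrier G - {\<one>}"
  by (induction rule: consistent.induct) (auto simp: legal_moves_iff)

lemma word_elem_closed: "set w \<subseteq> carrier G \<Longrightarrow> word_elem G w \<in> carrier G"
  by (induction w rule: rev_induct) (auto simp: word_elem_def)

lemma visited_closed: "set w \<subseteq> carrier G \<Longrightarrow> visited G w \<subseteq> carrier G"
  by (induction w rule: rev_induct) (auto simp: word_elem_closed)

lemma length_less_order:
  assumes "consistent G S P \<sigma> w" "\<not> revisits G w"
  shows "length w < order G"
proof -
  have "visited G w \<subseteq> carrier G"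
    using consistent_letters[OF assms(1)] by (intro visited_closed) auto
  then have "card (visited G w) \<le> order G"
    unfolding order_def using finite_carrier by (rule card_mono[rotated])
  then show ?thesis
    using card_visited[OF assms] by simp
qed

text \<open>Only the last letter of a play can cause a revisit, so the strict bound applies to the
  word before it.\<close>

lemma length_le_order:
  assumes "consistent G S P \<sigma> w"
  shows "length w \<le> order G"
proof (cases w rule: rev_cases)
  case (snoc v s)
  then have "length v < order G"
    using consistent_snocD(1,2)[of G S P \<sigma> v s] assms length_less_order game_over_iff by blast
  then show ?thesis
    using snoc by simp
qed simp

lemma no_infinite_play: "\<not> (\<exists>f. \<forall>n. consistent G S P \<sigma> (map f [0..<n]))"
proof
  assume "\<exists>f. \<forall>n. consistent G S P \<sigma> (map f [0..<n])"
  then obtain f where "consistent G S P \<sigma> (map f [0..<Suc (order G)])"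
    by blast
  from length_le_order[OF this] show False
    by simp
qed

lemma winning_strategyI:
  assumes legal: "\<And>w. consistent G S P \<sigma> w \<Longrightarrow> \<not> revisits G w \<Longrightarrow> to_move w = P \<Longrightarrow>
      \<sigma> w \<in> legal_moves G S w"
    and win: "\<And>w. consistent G S P \<sigma> w \<Longrightarrow> revisits G w \<Longrightarrow> winner \<Gamma> G w = P"
  shows "winning_strategy \<Gamma> G S P \<sigma>"
  unfolding winning_strategy_def game_over_iff using assms no_infinite_play by blast

text \<open>
  A letter leading to an unvisited vertex is neither the identity nor the inverse of the last
  letter, so the no-backtracking rule never forbids it.
\<close>

lemma ex_fresh_move:
  assumes w: "consistent G S P \<sigma> w" "\<not> revisits G w" and "Suc (length w) \<noteq> order G"
  shows "\<exists>s\<in>legal_moves G S w. \<not> revisits G (w @ [s])"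
proof -
  have lett: "set w \<subseteq> carrier G"
    using consistent_letters[OF w(1)] by auto
  then have g: "word_elem G w \<in> carrier G"
    by (rule word_elem_closed)
  \<comment> \<open>The excluded length is the one at which all vertices have been visited.\<close>
  have "card (visited G w) < card (carrier G)"
    using card_visited[OF w] length_less_order[OF w] assms(3) by (simp add: order_def)
  then obtain h where h: "h \<in> carrier G" "h \<notin> visited G w"
    by (metis card_mono finite_visited linorder_not_le subsetI)
  define s where "s = inv (word_elem G w) \<otimes> h"
  have s: "s \<in> carrier G" and ws: "word_elem G w \<otimes> s = h"
    using g h(1) by (auto simp: s_def m_assoc[symmetric])
  have "s \<noteq> \<one>"
    using ws g h(2) word_elem_in_visited by (metis r_one)
  moreover have "s \<noteq> inv (last w)" if ne: "w \<noteq> []"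
  proof
    assume inv: "s = inv (last w)"
    obtain v t where v: "w = v @ [t]"
      using ne by (cases w rule: rev_cases) auto
    \<comment> \<open>Backtracking cancels \<open>t\<close> and leads to the vertex of the prefix
      \<open>v\<close>, which is visited.\<close>
    then have "h = word_elem G v"
      using ws inv lett word_elem_closed[of v] by (simp add: m_assoc)
    then show False
      using h(2) v word_elem_in_visited by fastforce
  qed
  ultimately have "s \<in> legal_moves G S w"
    using s by (simp add: legal_moves_iff)
  moreover have "\<not> revisits G (w @ [s])"
    using ws h(2) by (simp add: revisits_snoc)
  ultimately show ?thesis
    by blast
qed

section \<open>Winning strategies for \<open>REL\<close> and \<open>RAV\<close>\<close>

lemma REL_Player1: "has_winning_strategy REL G S Player1"
proof -
  \<comment> \<open>Two letters have been played when Player 1 makes the third turn; the inverse of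
    their product closes the word to the identity.\<close>
  define \<sigma> where "\<sigma> w = (if length w = 2 then inv (word_elem G w)
    else (SOME s. s \<in> legal_moves G S w))" for w
  have two: "\<not> revisits G [a, b]" "inv (a \<otimes> b) \<in> legal_moves G S [a, b]"
    "revisits G [a, b, inv (a \<otimes> b)]"
    if con: "consistent G S Player1 \<sigma> [a, b]" for a b
  proof -
    have a: "a \<in> carrier G" "a \<noteq> \<one>" and b: "b \<in> carrier G" "b \<noteq> \<one>"
      using consistent_letters[OF con] by auto
    have "b \<in> legal_moves G S [a]"
      using con consistent_snocD(3)[of G S Player1 \<sigma> "[a]" b] by simp
    then have "b \<noteq> inv a"
      by (simp add: legal_moves_iff)
    then have ab: "a \<otimes> b \<noteq> \<one>"
      using a b by (metis inv_equality inv_inv)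
    moreover have "a \<otimes> b \<noteq> a"
      using a b by simp
    ultimately show "\<not> revisits G [a, b]"
      using a revisits_snoc[of G "[a]" b] visited_snoc[of G "[]" a] by (simp add: word_elem_def)
    \<comment> \<open>Equality would force \<open>a\<close> to be the identity, so the closing move
      does not backtrack.\<close>
    have "inv (a \<otimes> b) \<noteq> inv b"
      using a b by (metis inv_inv m_closed r_cancel_one)
    then show "inv (a \<otimes> b) \<in> legal_moves G S [a, b]"
      using ab a b by (simp add: legal_moves_iff)
    show "revisits G [a, b, inv (a \<otimes> b)]"
      using a b revisits_snoc[of G "[a, b]" "inv (a \<otimes> b)"] one_in_visited[of G "[a, b]"]
      by (simp add: word_elem_def)
  qed
  have three: "length w \<le> 3 \<and> (length w = 3 \<longrightarrow> revisits G w)"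
    if "consistent G S Player1 \<sigma> w" for w
    using that
  proof (induction w rule: rev_induct)
    case (snoc s w)
    note D = consistent_snocD[OF snoc.prems]
    have "length w \<le> 2"
      using snoc.IH[OF D(1)] D(2) by (auto simp: game_over_iff)
    moreover have "revisits G (w @ [s])" if len: "length w = 2"
    proof -
      obtain a b where ab: "w = [a, b]"
        using len by (cases w; cases "tl w") auto
      have ca: "a \<in> carrier G" "b \<in> carrier G"
        using consistent_letters[OF D(1)] ab by auto
      have "s = inv (a \<otimes> b)"
        using D(4) ab ca by (simp add: to_move_def \<sigma>_def word_elem_def)
      then show ?thesis
        using two(3) D(1) ab by simp
    qed
    ultimately show ?case
      by auto
  qed simp
  have "winning_strategy REL G S Player1 \<sigma>"
  proof (rule winning_strategyI)
    fix w
    assume w: "consistent G S Player1 \<sigma> w"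
    show "\<sigma> w \<in> legal_moves G S w"
    proof (cases "length w = 2")
      case True
      then obtain a b where ab: "w = [a, b]"
        by (cases w; cases "tl w") auto
      have "a \<in> carrier G"
        using consistent_letters[OF w] ab by auto
      then show ?thesis
        using two(2) w ab by (simp add: \<sigma>_def word_elem_def)
    next
      case False
      then show ?thesis
        using legal_moves_nonempty[of w] by (simp add: \<sigma>_def some_in_eq)
    qed
    assume rev: "revisits G w"
    have "length w \<noteq> 2"
    proof
      assume "length w = 2"
      then obtain a b where "w = [a, b]"
        by (cases w; cases "tl w") auto
      then show False
        using two(1) w rev by simp
    qed
    moreover have "length w \<noteq> 0"
      using rev by auto
    \<comment> \<open>Both lengths are odd, so Player 1 formed \<open>w\<close>.\<close>
    ultimately have "length w = 1 \<or> length w = 3"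
      using three[OF w] by linarith
    then show "winner REL G w = Player1"
      by (auto simp: to_move_def)
  qed
  then show ?thesis
    unfolding has_winning_strategy_def by blast
qed

text \<open>By \<open>last\<close>, \<open>P\<close> never moves with all vertices visited, so a
  fresh move always exists for \<open>P\<close> and any revisit is the opponent's.\<close>

lemma RAV_if_not_last_to_move:
  assumes last: "\<And>w :: 'a list. to_move w = P \<Longrightarrow> Suc (length w) \<noteq> order G"
  shows "has_winning_strategy RAV G S P"
proof -
  define \<sigma> where "\<sigma> w = (SOME s. s \<in> legal_moves G S w \<and> \<not> revisits G (w @ [s]))" for w
  have \<sigma>: "\<sigma> w \<in> legal_moves G S w \<and> \<not> revisits G (w @ [\<sigma> w])"
    if "consistent G S P \<sigma> w" "\<not> revisits G w" "to_move w = P" for w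
    unfolding \<sigma>_def using ex_fresh_move[OF that(1,2) last[OF that(3)]]
    by (intro someI_ex[where P = "\<lambda>s. s \<in> legal_moves G S w \<and> \<not> revisits G (w @ [s])"]) blast
  have "winning_strategy RAV G S P \<sigma>"
  proof (rule winning_strategyI)
    fix w
    assume w: "consistent G S P \<sigma> w" "revisits G w"
    then obtain v s where v: "w = v @ [s]"
      by (cases w rule: rev_cases) auto
    note D = consistent_snocD[OF w(1)[unfolded v]]
    \<comment> \<open>Otherwise \<open>s\<close> would be the fresh move chosen by the
      strategy.\<close>
    have "to_move v \<noteq> P"
      using D \<sigma>[of v] w(2) v by (auto simp: game_over_iff)
    then have "to_move w = P"
      using v by (cases P) (auto simp: to_move_def split: if_splits)
    then show "winner RAV G w = P"
      using w(2) by simp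
  qed (use \<sigma> in blast)
  then show ?thesis
    unfolding has_winning_strategy_def by blast
qed

end

section \<open>From the complete graph to the set of letters\<close>

lemma (in group) complete_cayley_letters:
  assumes "S \<subseteq> carrier G" "\<one> \<notin> S"
    and complete: "complete_digraph n (with_proj (cayley_graph G S))"
  shows "S \<union> (\<lambda>t. inv t) ` S = carrier G - {\<one>}"
proof
  show "S \<union> (\<lambda>t. inv t) ` S \<subseteq> carrier G - {\<one>}"
    using assms(1,2) by (auto simp: subset_iff)
  show "carrier G - {\<one>} \<subseteq> S \<union> (\<lambda>t. inv t) ` S"
  proof
    fix g
    assume g: "g \<in> carrier G - {\<one>}"
    \<comment> \<open>An edge at the identity makes its other end a generator or the inverse of
      one.\<close>
    then have "(\<one>, g) \<in> parcs (cayley_graph G S)"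
      using complete by (auto simp: complete_digraph_def cayley_graph_def)
    then obtain s where "s \<in> S" "g = \<one> \<otimes> s \<or> \<one> = g \<otimes> s"
      by (auto simp: cayley_graph_def)
    then show "g \<in> S \<union> (\<lambda>t. inv t) ` S"
      using g assms(1) by (metis DiffD1 UnI1 UnI2 image_eqI inv_equality l_one subsetD)
  qed
qed

theorem theorem2p6:
  fixes G :: "('a, 'b) monoid_scheme" and S :: "'a set"
  assumes "group G"
    and "finite (carrier G)"
    and "order G \<ge> 3"
    and "S \<subseteq> carrier G"
    and "\<one>\<^bsub>G\<^esub> \<notin> S"
    and "generate G S = carrier G"
    and "complete_digraph (order G) (with_proj (cayley_graph G S))"
  shows "has_winning_strategy REL G S Player1 \<and>
         (even (order G) \<longrightarrow> has_winning_strategy RAV G S Player1) \<and>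
         (odd (order G) \<longrightarrow> has_winning_strategy RAV G S Player2)"
proof -
  interpret group G
    by (rule assms(1))
  interpret complete_cayley_game G S
    using assms(2,3) complete_cayley_letters[OF assms(4,5,7)] by unfold_locales
  show ?thesis
  proof (intro conjI impI)
    show "has_winning_strategy REL G S Player1"
      by (rule REL_Player1)
    \<comment> \<open>Player 1 moves on odd-numbered turns and Player 2 on even-numbered ones, so
      the parity of the order decides who avoids the turn numbered \<open>order G\<close>.\<close>
    show "has_winning_strategy RAV G S Player1" if "even (order G)"
      using that by (intro RAV_if_not_last_to_move) (metis even_Suc to_move_def player.distinct(1))
    show "has_winning_strategy RAV G S Player2" if "odd (order G)"
      using that by (intro RAV_if_not_last_to_move) (metis even_Suc to_move_def player.distinct(1))
  qed
qed

end
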